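(* Let $\lambda\in P^+$. Then $\mathcal{B}(\lambda)\setminus\Gamma_\lambda=E_{\max}$, where $E_{\max}$ is the unique maximal proper extremal subset of $\mathcal{B}(\lambda)$.
   Context: Let $\mathfrak{g}$ be a finite-dimensional simple Lie algebra over $\mathbb{C}$, $I$ the index set of its simple roots, $P^+$ the set of dominant integral weights. For $\lambda\in P^+$, $\mathcal{B}(\lambda)$ denotes the crystal basis of the finite-dimensional irreducible $U_q(\mathfrak{g})$-module of highest weight $\lambda$, with Kashiwara operators $\tilde e_i,\tilde f_i:\mathcal{B}(\lambda)\to\mathcal{B}(\lambda)\sqcup\{0\}$ ($i\in I$). For $b\in\mathcal{B}(\lambda)$, $\tilde e_i^{\max}(b):=\tilde e_i^{k}(b)$ with $k\ge 0$ the largest integer such that $\tilde e_i^k(b)\neq 0$; $\tilde f_i^{\max}(b)$ is defined similarly. The $i$-string of $b$ is $S^i(b):=\{\tilde e_i^{\max}(b),\dots,\tilde e_i(b),b,\tilde f_i(b),\dots,\tilde f_i^{\max}(b)\}\setminus\{0\}$. A subset $X\subseteq\mathcal{B}(\lambda)$ is called extremal if $S^i(b)\cap X\in\{\varnothing,\,S^i(b),\,\{\tilde e_i^{\max}(b)\}\}$ for all $b\in\mathcal{B}(\lambda)$, $i\in I$. For $b\in\mathcal{B}(\lambda)$, $\langle b\rangle_{\mathrm{Ext}}$ denotes the intersection of all extremal subsets of $\mathcal{B}(\lambda)$ containing $b$. Set $\Gamma_\lambda:=\{b\in\mathcal{B}(\lambda)\mid\langle b\rangle_{\mathrm{Ext}}=\mathcal{B}(\lambda)\}$.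 $E_{\max}$ denotes the unique maximal (with respect to inclusion) extremal subset of $\mathcal{B}(\lambda)$ different from $\mathcal{B}(\lambda)$; it exists and equals the union of all proper extremal subsets of $\mathcal{B}(\lambda)$. *)

theory Defs
  imports
    "HOL-Computational_Algebra.Polynomial"
    "HOL-Computational_Algebra.Fraction_Field"
    "HOL-Library.Set_Algebras"
begin

section \<open>Finite-dimensional simple Lie algebras over the complex numbers\<close>

locale lie_algebra = vector_space sc
  for sc :: "complex \<Rightarrow> 'g::ab_group_add \<Rightarrow> 'g" +
  fixes br :: "'g \<Rightarrow> 'g \<Rightarrow> 'g"
  assumes br_linear_left: "Vector_Spaces.linear sc sc (\<lambda>x. br x y)"
    and br_linear_right: "Vector_Spaces.linear sc sc (br x)"
    and br_self: "br x x = 0"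
    and jacobi: "br x (br y z) + br y (br z x) + br z (br x y) = 0"
begin

definition lie_ideal :: "'g set \<Rightarrow> bool" where
  "lie_ideal J \<longleftrightarrow> subspace J \<and> (\<forall>x. \<forall>y\<in>J. br x y \<in> J)"

definition simple :: bool where
  "simple \<longleftrightarrow> (\<exists>x y. br x y \<noteq> 0) \<and> (\<forall>J. lie_ideal J \<longrightarrow> J = {0} \<or> J = UNIV)"

definition ad_diagonalizable :: "'g \<Rightarrow> bool" where
  "ad_diagonalizable x \<longleftrightarrow> span {y. \<exists>c. br x y = sc c y} = UNIV"

definition toral :: "'g set \<Rightarrow> bool" where
  "toral H \<longleftrightarrow> subspace H \<and> (\<forall>x\<in>H. \<forall>y\<in>H. br x y = 0) \<and> (\<forall>x\<in>H. ad_diagonalizable x)"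

text \<open>In a semisimple Lie algebra the Cartan subalgebras are the maximal toral subalgebras.\<close>

definition cartan_subalgebra :: "'g set \<Rightarrow> bool" where
  "cartan_subalgebra H \<longleftrightarrow> toral H \<and> (\<forall>H'. toral H' \<and> H \<subseteq> H' \<longrightarrow> H' = H)"

text \<open>Elements of the dual of \<open>H\<close> are represented by functions on the whole Lie algebra
  of which only the values on \<open>H\<close> are ever used.\<close>

definition root_space :: "'g set \<Rightarrow> ('g \<Rightarrow> complex) \<Rightarrow> 'g set" where
  "root_space H \<beta> = {x. \<forall>h\<in>H. br h x = sc (\<beta> h) x}"

definition is_root :: "'g set \<Rightarrow> ('g \<Rightarrow> complex) \<Rightarrow> bool" where
  "is_root H \<beta> \<longleftrightarrow> (\<exists>h\<in>H. \<beta> h \<noteq> 0) \<and> root_space H \<beta> \<noteq> {0}"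

definition simple_roots :: "'g set \<Rightarrow> ('i::finite \<Rightarrow> 'g \<Rightarrow> complex) \<Rightarrow> bool" where
  "simple_roots H \<alpha> \<longleftrightarrow>
     (\<forall>i. is_root H (\<alpha> i)) \<and>
     (\<forall>c. (\<forall>h\<in>H. (\<Sum>i\<in>UNIV. c i * \<alpha> i h) = 0) \<longrightarrow> (\<forall>i. c i = 0)) \<and>
     (\<forall>\<beta>. is_root H \<beta> \<longrightarrow>
        (\<exists>n :: 'i \<Rightarrow> int. (\<forall>h\<in>H. \<beta> h = (\<Sum>i\<in>UNIV. of_int (n i) * \<alpha> i h)) \<and>
                      ((\<forall>i. n i \<ge> 0) \<or> (\<forall>i. n i \<le> 0))))"

definition coroot :: "'g set \<Rightarrow> ('g \<Rightarrow> complex) \<Rightarrow> 'g" where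
  "coroot H \<beta> = (THE h. h \<in> span {br x y | x y. x \<in> root_space H \<beta> \<and>
                                                 y \<in> root_space H (\<lambda>h. - \<beta> h)} \<and>
                        \<beta> h = 2)"

text \<open>\<open>a\<^sub>i\<^sub>j = \<alpha>\<^sub>j(h\<^sub>i)\<close>, which is an integer.\<close>

definition cartan_matrix :: "'g set \<Rightarrow> ('i \<Rightarrow> 'g \<Rightarrow> complex) \<Rightarrow> 'i \<Rightarrow> 'i \<Rightarrow> int" where
  "cartan_matrix H \<alpha> i j = (THE n. of_int n = \<alpha> j (coroot H (\<alpha> i)))"

end

locale simple_lie_algebra = lie_algebra sc br
  for sc :: "complex \<Rightarrow> 'g::ab_group_add \<Rightarrow> 'g" and br +
  fixes H :: "'g set" and \<alpha> :: "'i::finite \<Rightarrow> 'g \<Rightarrow> complex"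
  assumes finite_dimensional: "\<exists>S. finite S \<and> span S = UNIV"
    and simple: "simple"
    and cartan_subalgebra: "cartan_subalgebra H"
    and simple_roots: "simple_roots H \<alpha>"

text \<open>\<open>d\<^sub>i = (\<alpha>\<^sub>i,\<alpha>\<^sub>i)/2\<close> for the invariant form with \<open>(\<alpha>,\<alpha>) = 2\<close> for short roots. For an
  indecomposable Cartan matrix this is its unique primitive positive symmetrizer.\<close>

definition symmetrizer :: "('i \<Rightarrow> 'i \<Rightarrow> int) \<Rightarrow> 'i \<Rightarrow> nat" where
  "symmetrizer a = (THE d. (\<forall>i. d i > 0) \<and> (\<forall>i j. int (d i) * a i j = int (d j) * a j i) \<and>
                           Gcd (range d) = 1)"

text \<open>The weight lattice \<open>P\<close> is identified with the integer vectors indexed by \<open>I\<close>: a weight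
  \<open>\<mu>\<close> is recorded by its values \<open>\<langle>h\<^sub>i, \<mu>\<rangle>\<close> on the simple coroots, which form a basis of \<open>H\<close>.\<close>

definition dominant :: "('i \<Rightarrow> int) \<Rightarrow> bool" where
  "dominant \<mu> \<longleftrightarrow> (\<forall>i. \<mu> i \<ge> 0)"


section \<open>Modules over the quantized enveloping algebra\<close>

type_synonym ratfun = "rat poly fract"

definition qvar :: ratfun where
  "qvar = Fract [:0, 1:] 1"

definition const :: "rat \<Rightarrow> ratfun" where
  "const c = Fract [:c:] 1"

definition regular_at_0 :: "ratfun set" where
  "regular_at_0 = {Fract f g | f g. poly g 0 \<noteq> 0}"

definition qint :: "ratfun \<Rightarrow> nat \<Rightarrow> ratfun" where
  "qint r n = (r ^ n - inverse r ^ n) / (r - inverse r)"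

definition qfact :: "ratfun \<Rightarrow> nat \<Rightarrow> ratfun" where
  "qfact r n = (\<Prod>k=1..n. qint r k)"

text \<open>A module over \<open>U\<^sub>q(\<gg>)\<close>, with \<open>U\<^sub>q(\<gg>)\<close> given by the usual presentation with generators
  \<open>E\<^sub>i\<close>, \<open>F\<^sub>i\<close>, \<open>K\<^sub>i\<close> and \<open>K\<^sub>i\<^sup>-\<^sup>1\<close> (here \<open>Kinv i\<close>), where \<open>K\<^sub>i\<close> stands for \<open>q\<close> to the power \<open>d\<^sub>i h\<^sub>i\<close>.\<close>

locale uq_module = vector_space sc
  for sc :: "ratfun \<Rightarrow> 'v::ab_group_add \<Rightarrow> 'v" +
  fixes a :: "'i::finite \<Rightarrow> 'i \<Rightarrow> int" and d :: "'i \<Rightarrow> nat"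
    and E F K Kinv :: "'i \<Rightarrow> 'v \<Rightarrow> 'v"
begin

definition q :: "'i \<Rightarrow> ratfun" where
  "q i = qvar ^ d i"

definition divpow :: "('i \<Rightarrow> 'v \<Rightarrow> 'v) \<Rightarrow> 'i \<Rightarrow> nat \<Rightarrow> 'v \<Rightarrow> 'v" where
  "divpow X i k v = sc (inverse (qfact (q i) k)) ((X i ^^ k) v)"

definition serre :: "('i \<Rightarrow> 'v \<Rightarrow> 'v) \<Rightarrow> bool" where
  "serre X \<longleftrightarrow> (\<forall>i j v. i \<noteq> j \<longrightarrow>
     (\<Sum>k\<le>nat (1 - a i j).
        sc ((-1) ^ k) (divpow X i k (X j (divpow X i (nat (1 - a i j) - k) v)))) = 0)"

definition uq_relations :: bool where
  "uq_relations \<longleftrightarrow>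
     (\<forall>i. Vector_Spaces.linear sc sc (E i) \<and> Vector_Spaces.linear sc sc (F i) \<and>
          Vector_Spaces.linear sc sc (K i) \<and> Vector_Spaces.linear sc sc (Kinv i)) \<and>
     (\<forall>i v. K i (Kinv i v) = v \<and> Kinv i (K i v) = v) \<and>
     (\<forall>i j v. K i (K j v) = K j (K i v)) \<and>
     (\<forall>i j v. K i (E j (Kinv i v)) = sc (q i powi a i j) (E j v)) \<and>
     (\<forall>i j v. K i (F j (Kinv i v)) = sc (q i powi (- a i j)) (F j v)) \<and>
     (\<forall>i j v. E i (F j v) - F j (E i v) =
        (if i = j then sc (1 / (q i - inverse (q i))) (K i v - Kinv i v) else 0)) \<and>
     serre E \<and> serre F"

definition weight_space :: "('i \<Rightarrow> int) \<Rightarrow> 'v set" where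
  "weight_space \<mu> = {v. \<forall>i. K i v = sc (q i powi \<mu> i) v}"

definition submodule :: "'v set \<Rightarrow> bool" where
  "submodule W \<longleftrightarrow> subspace W \<and>
     (\<forall>i. \<forall>w\<in>W. E i w \<in> W \<and> F i w \<in> W \<and> K i w \<in> W \<and> Kinv i w \<in> W)"

definition irreducible :: bool where
  "irreducible \<longleftrightarrow> (\<exists>v::'v. v \<noteq> 0) \<and> (\<forall>W. submodule W \<longrightarrow> W = {0} \<or> W = UNIV)"

definition fd_irreducible_module :: "('i \<Rightarrow> int) \<Rightarrow> bool" where
  "fd_irreducible_module wt \<longleftrightarrow>
     uq_relations \<and> (\<exists>S. finite S \<and> span S = UNIV) \<and> irreducible \<and>
     (\<exists>u. u \<noteq> 0 \<and> u \<in> weight_space wt \<and> (\<forall>i. E i u = 0))"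


section \<open>Crystal bases\<close>

text \<open>The decomposition of \<open>v\<close> as the sum of \<open>F\<^sub>i\<^sup>(\<^sup>k\<^sup>) v\<^sub>k\<close> with \<open>E\<^sub>i v\<^sub>k = 0\<close>. The condition that the
  weights \<open>\<nu>\<close> occurring in \<open>v\<^sub>k\<close> satisfy \<open>\<langle>h\<^sub>i, \<nu>\<rangle> \<ge> k\<close> makes it unique: terms with smaller
  \<open>\<langle>h\<^sub>i, \<nu>\<rangle>\<close> contribute zero.\<close>

definition string_decomp :: "'i \<Rightarrow> 'v \<Rightarrow> (nat \<Rightarrow> 'v) \<Rightarrow> bool" where
  "string_decomp i v vs \<longleftrightarrow>
     finite {k. vs k \<noteq> 0} \<and>
     (\<forall>k. E i (vs k) = 0 \<and> vs k \<in> span (\<Union>\<nu>\<in>{\<nu>. \<nu> i \<ge> int k}. weight_space \<nu>)) \<and>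
     v = (\<Sum>k | vs k \<noteq> 0. divpow F i k (vs k))"

definition kashiwara_e :: "'i \<Rightarrow> 'v \<Rightarrow> 'v" where
  "kashiwara_e i v = (THE w. \<exists>vs. string_decomp i v vs \<and>
      w = (\<Sum>k | vs k \<noteq> 0 \<and> k \<ge> 1. divpow F i (k - 1) (vs k)))"

definition kashiwara_f :: "'i \<Rightarrow> 'v \<Rightarrow> 'v" where
  "kashiwara_f i v = (THE w. \<exists>vs. string_decomp i v vs \<and>
      w = (\<Sum>k | vs k \<noteq> 0. divpow F i (k + 1) (vs k)))"

text \<open>\<open>L\<close> is a free module over the local ring \<open>regular_at_0\<close> whose scalar extension to the
  field of rational functions is the whole space, i.e. it is generated over that ring by a basis of
  the space.\<close>

definition lattice :: "'v set \<Rightarrow> bool" where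
  "lattice L \<longleftrightarrow> (\<exists>S. independent S \<and> span S = UNIV \<and>
     L = {\<Sum>x\<in>T. sc (c x) x | T c. finite T \<and> T \<subseteq> S \<and> c ` T \<subseteq> regular_at_0})"

definition crystal_lattice :: "'v set \<Rightarrow> bool" where
  "crystal_lattice L \<longleftrightarrow>
     lattice L \<and>
     (\<forall>v\<in>L. \<exists>M vs. finite M \<and> (\<forall>\<mu>\<in>M. vs \<mu> \<in> L \<inter> weight_space \<mu>) \<and> v = (\<Sum>\<mu>\<in>M. vs \<mu>)) \<and>
     (\<forall>i. kashiwara_e i ` L \<subseteq> L \<and> kashiwara_f i ` L \<subseteq> L)"

text \<open>Elements of \<open>L/qL\<close> are cosets \<open>v +o qL L\<close>, the zero being \<open>qL L\<close> itself. Sums of sets are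
  elementwise. Adding \<open>qL L\<close> has no effect on a coset, but it turns the image of a coset under a
  linear map preserving \<open>L\<close>, such as multiplication by a (possibly zero) scalar, into a full coset.\<close>

definition qL :: "'v set \<Rightarrow> 'v set" where
  "qL L = sc qvar ` L"

definition cosets :: "'v set \<Rightarrow> 'v set set" where
  "cosets L = (\<lambda>v. v +o qL L) ` L"

definition induced :: "'v set \<Rightarrow> ('v \<Rightarrow> 'v) \<Rightarrow> 'v set \<Rightarrow> 'v set" where
  "induced L T C = T ` C + qL L"

definition rat_basis :: "'v set \<Rightarrow> 'v set set \<Rightarrow> bool" where
  "rat_basis L B \<longleftrightarrow> B \<subseteq> cosets L \<and>
     (\<forall>C\<in>cosets L. \<exists>!c :: 'v set \<Rightarrow> rat. finite {b. c b \<noteq> 0} \<and> {b. c b \<noteq> 0} \<subseteq> B \<and>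
        C = (\<Sum>b | c b \<noteq> 0. induced L (sc (const (c b))) b) + qL L)"

definition crystal_basis :: "'v set \<Rightarrow> 'v set set \<Rightarrow> bool" where
  "crystal_basis L B \<longleftrightarrow>
     crystal_lattice L \<and>
     rat_basis L B \<and>
     (\<forall>b\<in>B. \<exists>\<mu>. \<exists>v\<in>L \<inter> weight_space \<mu>. b = v +o qL L) \<and>
     (\<forall>i. \<forall>b\<in>B. induced L (kashiwara_e i) b \<in> insert (qL L) B \<and>
                induced L (kashiwara_f i) b \<in> insert (qL L) B) \<and>
     (\<forall>i. \<forall>b\<in>B. \<forall>b'\<in>B. b' = induced L (kashiwara_f i) b \<longleftrightarrow> b = induced L (kashiwara_e i) b')"

text \<open>The Kashiwara operators on the crystal, with \<open>None\<close> for the adjoined zero.\<close>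

definition crystal_e :: "'v set \<Rightarrow> 'i \<Rightarrow> 'v set \<Rightarrow> 'v set option" where
  "crystal_e L i b =
     (let b' = induced L (kashiwara_e i) b in if b' = qL L then None else Some b')"

definition crystal_f :: "'v set \<Rightarrow> 'i \<Rightarrow> 'v set \<Rightarrow> 'v set option" where
  "crystal_f L i b =
     (let b' = induced L (kashiwara_f i) b in if b' = qL L then None else Some b')"

end


section \<open>Extremal subsets of a crystal\<close>

primrec iterate :: "('b \<Rightarrow> 'b option) \<Rightarrow> nat \<Rightarrow> 'b \<Rightarrow> 'b option" where
  "iterate g 0 b = Some b"
| "iterate g (Suc k) b = Option.bind (iterate g k b) g"

definition max_iterate :: "('b \<Rightarrow> 'b option) \<Rightarrow> 'b \<Rightarrow> 'b" where
  "max_iterate g b = the (iterate g (GREATEST k. iterate g k b \<noteq> None) b)"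

locale crystal_operators =
  fixes B :: "'b set" and e f :: "'i \<Rightarrow> 'b \<Rightarrow> 'b option"
begin

definition i_string :: "'i \<Rightarrow> 'b \<Rightarrow> 'b set" where
  "i_string i b = {b'. \<exists>k. iterate (e i) k b = Some b'} \<union> {b'. \<exists>k. iterate (f i) k b = Some b'}"

definition extremal :: "'b set \<Rightarrow> bool" where
  "extremal X \<longleftrightarrow> X \<subseteq> B \<and>
     (\<forall>b\<in>B. \<forall>i. i_string i b \<inter> X \<in> {{}, i_string i b, {max_iterate (e i) b}})"

definition ext_hull :: "'b \<Rightarrow> 'b set" where
  "ext_hull b = \<Inter>{X. extremal X \<and> b \<in> X}"

definition Gamma :: "'b set" where
  "Gamma = {b\<in>B. ext_hull b = B}"

definition maximal_proper_extremal :: "'b set \<Rightarrow> bool" where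
  "maximal_proper_extremal X \<longleftrightarrow> extremal X \<and> X \<noteq> B \<and>
     (\<forall>Y. extremal Y \<and> Y \<noteq> B \<and> X \<subseteq> Y \<longrightarrow> Y = X)"

definition unique_maximal_proper_extremal :: "'b set \<Rightarrow> bool" where
  "unique_maximal_proper_extremal X \<longleftrightarrow>
     maximal_proper_extremal X \<and> (\<forall>Y. maximal_proper_extremal Y \<longrightarrow> Y = X)"

end

end

theory Submission
  imports Defs "HOL-Computational_Algebra.Polynomial_Factorial"
begin

text \<open>An element \<open>b\<close> of \<open>B\<close> lies outside \<open>\<Gamma>\<close> exactly when some proper extremal subset contains it:
  \<open>B\<close> itself is extremal, because the Kashiwara operators map \<open>B\<close> into \<open>B\<close> and zero, so the
  intersection defining the hull of \<open>b\<close> is over a family containing \<open>B\<close>, and it is smaller than \<open>B\<close> exactly if the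
  family has another member. If \<open>B\<close> is finite, each proper extremal subset lies in a maximal one, and by
  uniqueness the maximal one is \<open>E\<^sub>m\<^sub>a\<^sub>x\<close> (\<open>diff_Gamma_eq\<close>).

  Finiteness of \<open>B\<close> is where finite-dimensionality enters. Since \<open>B\<close> is a \<open>\<rat>\<close>-basis of \<open>L/qL\<close>,
  representatives of its elements are linearly independent over \<open>\<rat>(q)\<close>: a nontrivial relation can be
  given polynomial coefficients, and reducing it modulo \<open>qL\<close> shows that all constant terms
  vanish; dividing by \<open>q\<close> and repeating kills every coefficient
  (\<open>poly_relation_trivial\<close>, \<open>rat_basis_finite\<close>). A family that is
  linearly independent in a finite-dimensional space is finite.\<close>

section \<open>Extremal subsets of a finite crystal\<close>

lemma iterate_in_closed_set:
  assumes "\<And>x y. x \<in> A \<Longrightarrow> g x = Some y \<Longrightarrow> y \<in> A" "x \<in> A" "iterate g k x = Some y"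
  shows "y \<in> A"
  using assms(3) by (induction k arbitrary: y) (auto simp: bind_eq_Some_conv intro: assms(1,2))

context crystal_operators
begin

lemma extremal_carrier:
  assumes "\<And>i b b'. b \<in> B \<Longrightarrow> e i b = Some b' \<Longrightarrow> b' \<in> B"
    and "\<And>i b b'. b \<in> B \<Longrightarrow> f i b = Some b' \<Longrightarrow> b' \<in> B"
  shows "extremal B"
proof -
  have "i_string i b \<subseteq> B" if "b \<in> B" for i b
    using that iterate_in_closed_set[of B "e i" b] iterate_in_closed_set[of B "f i" b] assms
    unfolding i_string_def by blast
  then show ?thesis
    by (auto simp: extremal_def Int_absorb2)
qed

text \<open>Finiteness puts every proper extremal subset below a maximal one; an infinite
  crystal could be an increasing union of proper extremal subsets, and then a unique maximal one
  need not contain the others.\<close>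

lemma proper_extremal_subset_maximal:
  assumes "finite B" "extremal X" "X \<noteq> B"
  obtains Y where "maximal_proper_extremal Y" "X \<subseteq> Y"
proof -
  let ?P = "{Y. extremal Y \<and> Y \<noteq> B}"
  have "?P \<subseteq> Pow B"
    by (auto simp: extremal_def)
  then have fin: "finite ?P"
    using assms(1) finite_subset by blast
  have X: "X \<in> ?P"
    using assms(2,3) by simp
  obtain Y where Y: "Y \<in> ?P" "X \<subseteq> Y" "\<forall>Z\<in>?P. Y \<subseteq> Z \<longrightarrow> Y = Z"
    using finite_has_maximal2[OF fin X] by (elim bexE conjE)
  then have "maximal_proper_extremal Y"
    unfolding maximal_proper_extremal_def by blast
  with Y(2) show thesis
    by (intro that)
qed

lemma Gamma_iff:
  assumes "extremal B" "b \<in> B"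
  shows "b \<in> Gamma \<longleftrightarrow> (\<forall>X. extremal X \<and> b \<in> X \<longrightarrow> X = B)"
proof -
  have "X \<subseteq> B" if "extremal X" for X
    using that by (simp add: extremal_def)
  then show ?thesis
    using assms unfolding Gamma_def ext_hull_def by blast
qed

lemma diff_Gamma_eq:
  assumes "finite B" "extremal B" "unique_maximal_proper_extremal M"
  shows "B - Gamma = M"
proof
  show "B - Gamma \<subseteq> M"
  proof
    fix b assume "b \<in> B - Gamma"
    then obtain X where X: "extremal X" "b \<in> X" "X \<noteq> B"
      using Gamma_iff[OF assms(2)] by blast
    obtain Y where "maximal_proper_extremal Y" "X \<subseteq> Y"
      using proper_extremal_subset_maximal[OF assms(1) X(1,3)] .
    with X(2) assms(3) show "b \<in> M"
      unfolding unique_maximal_proper_extremal_def by blast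
  qed
  have "extremal M" "M \<noteq> B" "M \<subseteq> B"
    using assms(3)
    by (auto simp: unique_maximal_proper_extremal_def maximal_proper_extremal_def extremal_def)
  then show "M \<subseteq> B - Gamma"
    using Gamma_iff[OF assms(2)] by blast
qed

end

section \<open>Lattices and their reduction at zero\<close>

lemma regular_at_0_closed:
  "0 \<in> regular_at_0" "to_fract p \<in> regular_at_0"
  "x \<in> regular_at_0 \<Longrightarrow> y \<in> regular_at_0 \<Longrightarrow> x + y \<in> regular_at_0"
  "x \<in> regular_at_0 \<Longrightarrow> y \<in> regular_at_0 \<Longrightarrow> x * y \<in> regular_at_0"
proof -
  show poly: "to_fract p \<in> regular_at_0" for p
    unfolding regular_at_0_def to_fract_def by (intro CollectI exI[of _ p] exI[of _ 1]) simp
  show "0 \<in> regular_at_0"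
    using poly[of 0] by simp
  assume "x \<in> regular_at_0" "y \<in> regular_at_0"
  then obtain f g f' g' where xy: "x = Fract f g" "poly g 0 \<noteq> 0" "y = Fract f' g'" "poly g' 0 \<noteq> 0"
    unfolding regular_at_0_def by blast
  then have nz: "g \<noteq> 0" "g' \<noteq> 0" "poly (g * g') 0 \<noteq> 0"
    by auto
  have "x + y = Fract (f * g' + f' * g) (g * g')" "x * y = Fract (f * f') (g * g')"
    using nz by (simp_all add: xy)
  with nz(3) show "x + y \<in> regular_at_0" "x * y \<in> regular_at_0"
    unfolding regular_at_0_def by blast+
qed

lemma qvar_nonzero: "qvar \<noteq> 0"
  by (simp add: qvar_def Zero_fract_def eq_fract)

lemma to_fract_pCons: "to_fract (pCons c p) = const c + qvar * to_fract p"
  by (simp add: const_def qvar_def to_fract_def)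

lemma common_denominator:
  fixes u :: "'a \<Rightarrow> 'b::idom fract"
  assumes "finite T"
  obtains g p where "g \<noteq> 0" "\<And>x. x \<in> T \<Longrightarrow> to_fract g * u x = to_fract (p x)"
proof -
  have "\<exists>f h. h \<noteq> 0 \<and> u x = Fract f h" for x
    by (cases "u x") auto
  then obtain f h where fh: "\<And>x. h x \<noteq> 0" "\<And>x. u x = Fract (f x) (h x)"
    by metis
  define g where "g = (\<Prod>x\<in>T. h x)"
  have "to_fract g * u x = to_fract (f x * (\<Prod>y\<in>T - {x}. h y))" if "x \<in> T" for x
    using fh(1)[of x] prod.remove[OF assms that, of h] unfolding g_def fh(2) to_fract_def
    by (simp add: eq_fract algebra_simps)
  moreover have "g \<noteq> 0"
    using fh(1) assms by (simp add: g_def)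
  ultimately show thesis
    by (intro that)
qed

context uq_module
begin

lemma lattice_closed:
  assumes "lattice L"
  shows lattice_zero: "0 \<in> L"
    and lattice_add: "x \<in> L \<Longrightarrow> y \<in> L \<Longrightarrow> x + y \<in> L"
    and lattice_scale: "r \<in> regular_at_0 \<Longrightarrow> x \<in> L \<Longrightarrow> sc r x \<in> L"
proof -
  from assms obtain S where
    L: "L = {\<Sum>x\<in>T. sc (c x) x | T c. finite T \<and> T \<subseteq> S \<and> c ` T \<subseteq> regular_at_0}"
    unfolding lattice_def by blast
  show "0 \<in> L"
    unfolding L by (intro CollectI exI[of _ "{}"]) auto
  show "x + y \<in> L" if "x \<in> L" "y \<in> L"
  proof -
    from that obtain T c T' c' where
      T: "x = (\<Sum>x\<in>T. sc (c x) x)" "finite T" "T \<subseteq> S" "c ` T \<subseteq> regular_at_0" and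
      T': "y = (\<Sum>x\<in>T'. sc (c' x) x)" "finite T'" "T' \<subseteq> S" "c' ` T' \<subseteq> regular_at_0"
      unfolding L by blast
    define c1 where "c1 z = (if z \<in> T then c z else 0)" for z
    define c2 where "c2 z = (if z \<in> T' then c' z else 0)" for z
    have "x = (\<Sum>z\<in>T \<union> T'. sc (c1 z) z)" "y = (\<Sum>z\<in>T \<union> T'. sc (c2 z) z)"
      unfolding T(1) T'(1) using T(2) T'(2)
      by (auto intro!: sum.mono_neutral_cong_left simp: c1_def c2_def)
    then have "x + y = (\<Sum>z\<in>T \<union> T'. sc (c1 z + c2 z) z)"
      by (simp add: scale_left_distrib sum.distrib)
    moreover have "(\<lambda>z. c1 z + c2 z) ` (T \<union> T') \<subseteq> regular_at_0"
      using T(4) T'(4) by (auto simp: c1_def c2_def image_subset_iff intro: regular_at_0_closed)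
    ultimately show ?thesis
      unfolding L using T(2,3) T'(2,3)
      by (intro CollectI exI[of _ "T \<union> T'"] exI[of _ "\<lambda>z. c1 z + c2 z"]) simp
  qed
  show "sc r x \<in> L" if r: "r \<in> regular_at_0" and "x \<in> L"
  proof -
    from that obtain T c where
      T: "x = (\<Sum>x\<in>T. sc (c x) x)" "finite T" "T \<subseteq> S" "c ` T \<subseteq> regular_at_0"
      unfolding L by blast
    have "sc r x = (\<Sum>z\<in>T. sc (r * c z) z)"
      by (simp add: T(1) scale_sum_right)
    moreover have "(\<lambda>z. r * c z) ` T \<subseteq> regular_at_0"
      using T(4) r by (auto simp: image_subset_iff intro: regular_at_0_closed)
    ultimately show ?thesis
      unfolding L using T(2,3) by (intro CollectI exI[of _ T] exI[of _ "\<lambda>z. r * c z"]) simp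
  qed
qed

lemma lattice_sum: "lattice L \<Longrightarrow> (\<And>x. x \<in> T \<Longrightarrow> g x \<in> L) \<Longrightarrow> sum g T \<in> L"
  by (induction T rule: infinite_finite_induct) (auto intro: lattice_zero lattice_add)

lemma qL_closed:
  assumes "lattice L"
  shows qL_zero: "0 \<in> qL L"
    and qL_add: "x \<in> qL L \<Longrightarrow> y \<in> qL L \<Longrightarrow> x + y \<in> qL L"
    and qL_scale: "r \<in> regular_at_0 \<Longrightarrow> x \<in> qL L \<Longrightarrow> sc r x \<in> qL L"
proof -
  show "0 \<in> qL L"
    using lattice_zero[OF assms] unfolding qL_def by (intro image_eqI[of _ _ 0]) auto
  show "x + y \<in> qL L" if "x \<in> qL L" "y \<in> qL L"
    using that lattice_add[OF assms] unfolding qL_def by (auto simp flip: scale_right_distrib)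
  show "sc r x \<in> qL L" if "r \<in> regular_at_0" "x \<in> qL L"
  proof -
    from that(2) obtain y where y: "y \<in> L" "x = sc qvar y"
      unfolding qL_def by blast
    then have "sc r x = sc qvar (sc r y)"
      by (simp add: mult.commute)
    then show ?thesis
      using lattice_scale[OF assms that(1) y(1)] unfolding qL_def by blast
  qed
qed

lemma qL_plus_qL: "lattice L \<Longrightarrow> qL L + qL L = qL L"
  using qL_add[of L] qL_zero[of L] by (force simp: set_plus_def)

lemma coset_of_qL: "lattice L \<Longrightarrow> x \<in> qL L \<Longrightarrow> x +o qL L = qL L"
proof -
  assume L: "lattice L" and x: "x \<in> qL L"
  have "to_fract (-1) \<in> regular_at_0"
    by (rule regular_at_0_closed)
  then have m: "- x \<in> qL L"
    using qL_scale[OF L _ x, of "to_fract (-1)"] by simp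
  have "z \<in> x +o qL L" if "z \<in> qL L" for z
    using qL_add[OF L m that] by (auto simp: elt_set_plus_def intro!: bexI[of _ "- x + z"])
  then show ?thesis
    using qL_add[OF L x] by (auto simp: elt_set_plus_def)
qed

lemma induced_scale_coset:
  assumes "lattice L" "r \<in> regular_at_0"
  shows "induced L (sc r) (v +o qL L) = sc r v +o qL L"
proof
  show "induced L (sc r) (v +o qL L) \<subseteq> sc r v +o qL L"
    using qL_add[OF assms(1)] qL_scale[OF assms]
    by (auto simp: induced_def elt_set_plus_def set_plus_def scale_right_distrib add.assoc)
  have "v \<in> v +o qL L"
    using qL_zero[OF assms(1)] by (auto simp: elt_set_plus_def)
  then show "sc r v +o qL L \<subseteq> induced L (sc r) (v +o qL L)"
    by (auto simp: induced_def elt_set_plus_def set_plus_def)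
qed

lemma sum_cosets:
  assumes "lattice L" "finite T"
  shows "(\<Sum>x\<in>T. g x +o qL L) + qL L = (\<Sum>x\<in>T. g x) +o qL L"
  using assms(2)
proof (induction T)
  case (insert x T)
  then have "(\<Sum>y\<in>insert x T. g y +o qL L) + qL L = (g x +o qL L) + ((\<Sum>y\<in>T. g y +o qL L) + qL L)"
    by (simp add: add.assoc)
  also have "\<dots> = (g x + (\<Sum>y\<in>T. g y)) +o (qL L + qL L)"
    by (simp add: insert.IH set_plus_rearrange)
  finally show ?case
    using insert.hyps by (simp add: qL_plus_qL[OF assms(1)])
qed simp

section \<open>Finiteness of a crystal basis\<close>

text \<open>The zero coset has the empty expansion, so the uniqueness part of being a basis of \<open>L/qL\<close> is
  linear independence over \<open>\<rat>\<close>, here expressed on representatives \<open>v b\<close> in the lattice.\<close>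

lemma rat_basis_independent:
  assumes L: "lattice L" and B: "rat_basis L B" and T: "finite T" "T \<subseteq> B"
    and v: "\<And>b. b \<in> T \<Longrightarrow> v b +o qL L = b"
    and rel: "(\<Sum>b\<in>T. sc (const (c b)) (v b)) \<in> qL L" and b: "b \<in> T"
  shows "c b = 0"
proof -
  define c' where "c' b = (if b \<in> T then c b else 0)" for b
  let ?expands = "\<lambda>c. finite {b. c b \<noteq> 0} \<and> {b. c b \<noteq> 0} \<subseteq> B \<and>
      qL L = (\<Sum>b | c b \<noteq> 0. induced L (sc (const (c b))) b) + qL L"
  have supp: "{b. c' b \<noteq> 0} \<subseteq> T"
    by (auto simp: c'_def)
  then have fin: "finite {b. c' b \<noteq> 0}"
    using T(1) finite_subset by blast
  have reg: "const r \<in> regular_at_0" for r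
    using regular_at_0_closed(2)[of "[:r:]"] by (simp add: const_def to_fract_def)
  have "(\<Sum>b | c' b \<noteq> 0. induced L (sc (const (c' b))) b)
      = (\<Sum>b | c' b \<noteq> 0. sc (const (c' b)) (v b) +o qL L)"
  proof (rule sum.cong)
    fix b assume "b \<in> {b. c' b \<noteq> 0}"
    then have "b \<in> T"
      using supp by blast
    then show "induced L (sc (const (c' b))) b = sc (const (c' b)) (v b) +o qL L"
      using induced_scale_coset[OF L reg, of "c' b" "v b"] by (simp add: v)
  qed simp
  then have "(\<Sum>b | c' b \<noteq> 0. induced L (sc (const (c' b))) b) + qL L
      = (\<Sum>b | c' b \<noteq> 0. sc (const (c' b)) (v b)) +o qL L"
    using sum_cosets[OF L fin] by simp
  also have "(\<Sum>b | c' b \<noteq> 0. sc (const (c' b)) (v b)) = (\<Sum>b\<in>T. sc (const (c b)) (v b))"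
    using T(1) supp
    by (intro sum.mono_neutral_cong_left) (auto simp: c'_def const_def Zero_fract_def)
  finally have 1: "?expands c'"
    using coset_of_qL[OF L rel] fin supp T(2) by auto
  have 2: "?expands (\<lambda>_. 0)"
    by simp
  have "0 +o qL L \<in> cosets L"
    using lattice_zero[OF L] unfolding cosets_def by blast
  then have "qL L \<in> cosets L"
    by simp
  then have ex1: "\<exists>!c. ?expands c"
    by (rule bspec[OF conjunct2[OF B[unfolded rat_basis_def]]])
  have "c' = (\<lambda>_. 0)"
    using the1_equality[OF ex1, OF 1] the1_equality[OF ex1, OF 2] by (rule trans[OF sym])
  then have "c' b = 0"
    by simp
  with b show ?thesis
    by (simp add: c'_def)
qed

text \<open>Modulo \<open>qL\<close> only the constant terms of the coefficients survive, and by independence of the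
  basis they vanish. Hence the relation is divisible by \<open>q\<close>, and dividing by it lowers every
  coefficient index by one.\<close>

lemma poly_relation_trivial:
  assumes L: "lattice L" and B: "rat_basis L B" and T: "finite T" "T \<subseteq> B"
    and v: "\<And>b. b \<in> T \<Longrightarrow> v b \<in> L" "\<And>b. b \<in> T \<Longrightarrow> v b +o qL L = b"
    and rel: "(\<Sum>b\<in>T. sc (to_fract (p b)) (v b)) = 0" and b: "b \<in> T"
  shows "p b = 0"
proof -
  have step: "(\<forall>b\<in>T. coeff (p b) 0 = 0) \<and> (\<Sum>b\<in>T. sc (to_fract (poly_shift 1 (p b))) (v b)) = 0"
    if rel: "(\<Sum>b\<in>T. sc (to_fract (p b)) (v b)) = 0" for p
  proof -
    \<comment> \<open>Splitting off the constant terms writes the relation as a rational combination of the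
      representatives plus \<open>q\<close> times the vector \<open>w\<close> of \<open>L\<close>.\<close>
    define w where "w = (\<Sum>b\<in>T. sc (to_fract (poly_shift 1 (p b))) (v b))"
    have "p b = pCons (coeff (p b) 0) (poly_shift 1 (p b))" for b
      by (rule poly_eqI) (simp add: coeff_poly_shift coeff_pCons split: nat.split)
    then have split: "to_fract (p b) = const (coeff (p b) 0) + qvar * to_fract (poly_shift 1 (p b))"
      for b
      by (metis to_fract_pCons)
    have "0 = (\<Sum>b\<in>T. sc (const (coeff (p b) 0) + qvar * to_fract (poly_shift 1 (p b))) (v b))"
      using rel by (simp only: split[symmetric])
    also have "\<dots> = (\<Sum>b\<in>T. sc (const (coeff (p b) 0)) (v b)) + sc qvar w"
      by (simp add: w_def scale_left_distrib sum.distrib scale_sum_right)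
    finally have eq: "(\<Sum>b\<in>T. sc (const (coeff (p b) 0)) (v b)) = sc qvar (- w)"
      by (simp add: eq_neg_iff_add_eq_0)
    have "- w = (\<Sum>b\<in>T. sc (to_fract (- poly_shift 1 (p b))) (v b))"
      by (simp add: w_def sum_negf)
    also have "\<dots> \<in> L"
      by (intro lattice_sum[OF L] lattice_scale[OF L] regular_at_0_closed(2) v(1))
    finally have "(\<Sum>b\<in>T. sc (const (coeff (p b) 0)) (v b)) \<in> qL L"
      unfolding eq qL_def by blast
    from rat_basis_independent[OF L B T v(2) this] have c0: "\<forall>b\<in>T. coeff (p b) 0 = 0"
      by simp
    have "const 0 = 0"
      by (simp add: const_def Zero_fract_def)
    then have "sc qvar (- w) = 0"
      using eq c0 by simp
    then have "w = 0"
      using qvar_nonzero by simp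
    with c0 show ?thesis
      by (simp add: w_def)
  qed
  have "\<forall>b\<in>T. coeff (p b) n = 0" for n
    using rel
  proof (induction n arbitrary: p)
    case 0
    then show ?case
      using step by blast
  next
    case (Suc n)
    then show ?case
      using step[OF Suc.prems] Suc.IH[of "\<lambda>b. poly_shift 1 (p b)"] by (simp add: coeff_poly_shift)
  qed
  with b show ?thesis
    by (simp add: poly_eq_iff)
qed

lemma rat_basis_finite:
  assumes L: "lattice L" and B: "rat_basis L B" and fd: "finite S" "span S = UNIV"
  shows "finite B"
proof -
  have "\<exists>v. v \<in> L \<and> v +o qL L = b" if "b \<in> B" for b
    using B that unfolding rat_basis_def cosets_def by blast
  then obtain v where v: "\<And>b. b \<in> B \<Longrightarrow> v b \<in> L" "\<And>b. b \<in> B \<Longrightarrow> v b +o qL L = b"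
    by metis
  then have inj: "inj_on v B"
    by (intro inj_on_inverseI[of _ "\<lambda>x. x +o qL L"])
  have "independent (v ` B)"
  proof
    assume "dependent (v ` B)"
    then obtain t u where t: "finite t" "t \<subseteq> v ` B" "(\<Sum>x\<in>t. sc (u x) x) = 0" "\<exists>x\<in>t. u x \<noteq> 0"
      unfolding dependent_explicit by blast
    obtain T where T: "T \<subseteq> B" "t = v ` T"
      using t(2) by (meson subset_imageE)
    have inj_T: "inj_on v T"
      using inj T(1) inj_on_subset by blast
    then have fin: "finite T"
      using t(1) T(2) finite_imageD by blast
    obtain g p where g: "g \<noteq> 0" "\<And>b. b \<in> T \<Longrightarrow> to_fract g * u (v b) = to_fract (p b)"
      using common_denominator[OF fin, of "\<lambda>b. u (v b)"] by metis
    have "(\<Sum>b\<in>T. sc (u (v b)) (v b)) = 0"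
      using t(3) unfolding T(2) by (simp add: sum.reindex[OF inj_T])
    then have "sc (to_fract g) (\<Sum>b\<in>T. sc (u (v b)) (v b)) = 0"
      by simp
    then have rel: "(\<Sum>b\<in>T. sc (to_fract (p b)) (v b)) = 0"
      using g(2) by (simp add: scale_sum_right)
    have "p b = 0" if "b \<in> T" for b
      by (rule poly_relation_trivial[OF L B fin T(1) _ _ rel that]) (use v T(1) in auto)
    then have "u (v b) = 0" if "b \<in> T" for b
      using g that by force
    with t(4) T(2) show False
      by blast
  qed
  then have "finite (v ` B)"
    using independent_span_bound[OF fd(1)] fd(2) by simp
  then show ?thesis
    using inj finite_imageD by blast
qed

section \<open>The complement of the generators\<close>

lemma crystal_operators_closed:
  assumes "crystal_basis L B" "b \<in> B"
  shows "crystal_e L i b = Some b' \<Longrightarrow> b' \<in> B" "crystal_f L i b = Some b' \<Longrightarrow> b' \<in> B"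
proof -
  have "\<forall>i. \<forall>b\<in>B. induced L (kashiwara_e i) b \<in> insert (qL L) B \<and>
      induced L (kashiwara_f i) b \<in> insert (qL L) B"
    using assms(1) unfolding crystal_basis_def by (elim conjE)
  then have "induced L (kashiwara_e i) b \<in> insert (qL L) B"
      "induced L (kashiwara_f i) b \<in> insert (qL L) B"
    using assms(2) by simp_all
  then show "crystal_e L i b = Some b' \<Longrightarrow> b' \<in> B" "crystal_f L i b = Some b' \<Longrightarrow> b' \<in> B"
    unfolding crystal_e_def crystal_f_def by (simp_all add: Let_def split: if_splits)
qed

end

theorem proposition3p7:
  fixes sg :: "complex \<Rightarrow> 'g::ab_group_add \<Rightarrow> 'g" and br :: "'g \<Rightarrow> 'g \<Rightarrow> 'g"
    and H :: "'g set" and \<alpha> :: "'i::finite \<Rightarrow> 'g \<Rightarrow> complex"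
    and wt :: "'i \<Rightarrow> int"
    and sc :: "rat poly fract \<Rightarrow> 'v::ab_group_add \<Rightarrow> 'v"
    and E F K Kinv :: "'i \<Rightarrow> 'v \<Rightarrow> 'v"
    and a :: "'i \<Rightarrow> 'i \<Rightarrow> int" and d :: "'i \<Rightarrow> nat"
    and L :: "'v set" and B :: "'v set set"
    and e f :: "'i \<Rightarrow> 'v set \<Rightarrow> 'v set option"
    and E_max :: "'v set set"
  assumes "simple_lie_algebra sg br H \<alpha>"
    and "a = lie_algebra.cartan_matrix sg br H \<alpha>"
    and "d = symmetrizer a"
    and "dominant wt"
    and "uq_module sc"
    and "uq_module.fd_irreducible_module sc a d E F K Kinv wt"
    and "uq_module.crystal_basis sc d E F K L B"
    and "e = uq_module.crystal_e sc d E F K L"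
    and "f = uq_module.crystal_f sc d E F K L"
    and "crystal_operators.unique_maximal_proper_extremal B e f E_max"
  shows "B - crystal_operators.Gamma B e f = E_max"
proof -
  interpret uq_module sc a d E F K Kinv
    by fact
  have "lattice L"
    using assms(7) unfolding crystal_basis_def crystal_lattice_def by (elim conjE)
  moreover have "rat_basis L B"
    using assms(7) unfolding crystal_basis_def by (elim conjE)
  moreover have "\<exists>S. finite S \<and> span S = UNIV"
    using assms(6) unfolding fd_irreducible_module_def by (elim conjE)
  ultimately have "finite B"
    using rat_basis_finite by blast
  moreover have "crystal_operators.extremal B e f B"
    unfolding assms(8,9)
  proof (rule crystal_operators.extremal_carrier)
    show "b' \<in> B" if "b \<in> B" "crystal_e L i b = Some b'" for i b b'
      using crystal_operators_closed(1)[OF assms(7) that] .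
    show "b' \<in> B" if "b \<in> B" "crystal_f L i b = Some b'" for i b b'
      using crystal_operators_closed(2)[OF assms(7) that] .
  qed
  ultimately show ?thesis
    using assms(10) by (rule crystal_operators.diff_Gamma_eq)
qed

end
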